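(* Let $m\ge 1$ be an integer and let $\mu\in\mathcal{P}_1^+$ be a Borel probability distribution on $\mathbb{R}^{m+1}$ whose expectation $m(\mu)$ is a vector with strictly positive coordinates. Let $X_1,X_2,\dots$ be independent $\mathbb{R}^{m+1}_+$-valued random variables, each with distribution $\mu$, and let $$\widehat{\mu}_N=\frac{1}{N}\sum_{i=1}^N\delta_{X_i}$$ be the empirical measure. Then, with probability 1, the sequence $G(Z(\widehat{\mu}_N))$ is eventually defined (i.e. defined for all sufficiently large $N$) and converges to $G(Z(\mu))$ as $N\to\infty$.
   Context: $\mathbb{R}^{m+1}_+=\{x\in\mathbb{R}^{m+1}: x\ge 0\}$, where inequalities between vectors are componentwise. $\mathcal{P}_1^+$ is the set of Borel probability measures on $\mathbb{R}^{m+1}$ with support contained in $\mathbb{R}^{m+1}_+$ and finite first moment; the expectation of $\mu\in\mathcal{P}_1^+$ is the vector $m(\mu)=\int x\,d\mu(x)\in\mathbb{R}^{m+1}_+$ (componentwise integral; the function $m(\cdot)$ is unrelated to the integer $m$). $\delta_x$ is the Dirac measure at $x$. The zonoid of $\mu$ is $$Z(\mu)=\left\{\int_{\mathbb{R}^{m+1}}\phi(x)\,x\,d\mu(x)\ :\ \phi\colon\mathbb{R}^{m+1}\to[0,1]\text{ measurable}\right\},$$ a compact convex subset of $\mathbb{R}^{m+1}$. The parallelotope of $\mu$ is $P(\mu)=\{z\in\mathbb{R}^{m+1}: 0\le z\le m(\mu)\}$. $V_{m+1}$ is $(m+1)$-dimensional volume (Lebesgue measure). The (generalized) Gini index related to $\mu\in\mathcal{P}_1^+$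 is defined when $m(\mu)$ has strictly positive coordinates (equivalently $V_{m+1}(P(\mu))\neq0$), and is then $$G(Z(\mu))=\frac{V_{m+1}(Z(\mu))}{V_{m+1}(P(\mu))}.$$ *)

theory Defs
  imports "HOL-Probability.Probability"
begin

definition measure_support :: "'a::topological_space measure \<Rightarrow> 'a set" where
  "measure_support \<mu> = {x. \<forall>U. open U \<and> x \<in> U \<longrightarrow> 0 < emeasure \<mu> U}"

text \<open>On \<open>real ^ 'n\<close> the relation \<open>\<le>\<close> is componentwise, but \<open>x < y\<close> only means
  \<open>x \<le> y \<and> x \<noteq> y\<close>; strict positivity of a vector is therefore always written out by
  coordinates.\<close>

definition P1_plus :: "(real ^ 'n::finite) measure set" where
  "P1_plus = {\<mu>. sets \<mu> = sets borel \<and> prob_space \<mu> \<and>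
                 measure_support \<mu> \<subseteq> {x. 0 \<le> x} \<and> integrable \<mu> norm}"

definition mean_vector :: "(real ^ 'n::finite) measure \<Rightarrow> real ^ 'n" where
  "mean_vector \<mu> = (\<chi> j. \<integral>x. x $ j \<partial>\<mu>)"

definition zonoid :: "(real ^ 'n::finite) measure \<Rightarrow> (real ^ 'n) set" where
  "zonoid \<mu> = {(\<integral>x. \<phi> x *\<^sub>R x \<partial>\<mu>) | \<phi>.
                 \<phi> \<in> borel_measurable borel \<and> (\<forall>x. \<phi> x \<in> {0..1})}"

definition parallelotope :: "(real ^ 'n::finite) measure \<Rightarrow> (real ^ 'n) set" where
  "parallelotope \<mu> = {z. 0 \<le> z \<and> z \<le> mean_vector \<mu>}"

definition gini_defined :: "(real ^ 'n::finite) measure \<Rightarrow> bool" where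
  "gini_defined \<mu> \<longleftrightarrow> \<mu> \<in> P1_plus \<and> (\<forall>j. 0 < mean_vector \<mu> $ j)"

text \<open>Meaningful only under \<^const>\<open>gini_defined\<close>; division by zero makes it total.\<close>

definition gini_index :: "(real ^ 'n::finite) measure \<Rightarrow> real" where
  "gini_index \<mu> = measure lebesgue (zonoid \<mu>) / measure lebesgue (parallelotope \<mu>)"

text \<open>Measures carry no addition in the library, so \<open>1/N (\<delta>\<^bsub>x 1\<^esub> + \<dots> + \<delta>\<^bsub>x N\<^esub>)\<close>
  is given by its values on Borel sets, with \<open>\<delta>\<^bsub>y\<^esub> = return borel y\<close>.\<close>

definition empirical_measure :: "nat \<Rightarrow> (nat \<Rightarrow> 'a::topological_space) \<Rightarrow> 'a measure" where
  "empirical_measure N x = measure_of UNIV (sets borel)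
     (\<lambda>A. (\<Sum>i=1..N. emeasure (return borel (x i)) A) / of_nat N)"

lemma space_empirical_measure [simp]: "space (empirical_measure N x) = UNIV"
  by (simp add: empirical_measure_def)

lemma sets_empirical_measure [simp, measurable_cong]:
  "sets (empirical_measure N x) = sets borel"
  unfolding empirical_measure_def
  by (metis sets.sets_measure_of_eq space_borel)

text \<open>The prescribed set function is countably additive, so \<^const>\<open>measure_of\<close> does not
  fall back to the zero measure.\<close>

lemma emeasure_empirical_measure:
  assumes "A \<in> sets borel"
  shows "emeasure (empirical_measure N x) A =
    (\<Sum>i=1..N. emeasure (return borel (x i)) A) / of_nat N"
proof -
  let ?f = "\<lambda>A. (\<Sum>i=1..N. emeasure (return borel (x i)) A) / (of_nat N :: ennreal)"
  have ca: "countably_additive (sets borel) ?f"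
  proof (rule countably_additiveI)
    fix B :: "nat \<Rightarrow> 'a set"
    assume B: "range B \<subseteq> sets borel" "disjoint_family B" "(\<Union>i. B i) \<in> sets borel"
    have "(\<Sum>n. ?f (B n)) = (\<Sum>n. (\<Sum>i=1..N. emeasure (return borel (x i)) (B n))) / of_nat N"
      by simp
    also have "(\<Sum>n. (\<Sum>i=1..N. emeasure (return borel (x i)) (B n))) =
        (\<Sum>i=1..N. (\<Sum>n. emeasure (return borel (x i)) (B n)))"
      by (rule suminf_sum) auto
    also have "\<dots> = (\<Sum>i=1..N. emeasure (return borel (x i)) (\<Union>n. B n))"
      using B by (intro sum.cong refl suminf_emeasure) auto
    finally show "(\<Sum>n. ?f (B n)) = ?f (\<Union>n. B n)" .
  qed
  show ?thesis
    by (rule emeasure_measure_of[OF empirical_measure_def])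
      (use ca assms in \<open>auto simp: positive_def\<close>)
qed

end

theory Submission
  imports Defs
begin

text \<open>The numerator and the denominator of the index converge almost surely, and the limit of the
denominator is positive.

The volume of the parallelotope is the product of the coordinates of the mean vector, so
the denominator is a matter of the strong law of large numbers for each coordinate, which also
makes the empirical means eventually positive.

The zonoids are bounded convex sets, and the volume of convex sets depends continuously on
them: if \<open>x\<close> is interior to \<open>Z(\<mu>)\<close>, it eventually lies in \<open>Z(\<mu>\<^sub>N)\<close>, and if \<open>x\<close> is outside the closure, it
eventually lies outside \<open>Z(\<mu>\<^sub>N)\<close>. The frontier of a convex set is negligible, so dominated
convergence of the indicator functions applies (\<open>convex_volume_tendsto\<close>). Each of the two claims needs the
convergence of countably many sample averages only. For the first, choose weight functions \<open>\<phi>\<close> whose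
points \<open>\<integral> \<phi>(x) x d\<mu>\<close> are dense in \<open>Z(\<mu>)\<close>; the corresponding points of \<open>Z(\<mu>\<^sub>N)\<close> converge to them. For the
second, the support function of \<open>Z(\<mu>)\<close> in direction \<open>u\<close> is the integral of \<open>max 0 (u \<bullet> x)\<close>,
and a dense set of directions suffices. This is \<open>zonoid_volume_empirical_tendsto\<close>.

Only first moments are available, so the strong law is needed in Kolmogorov's form. It is proved
by Etemadi's route (\<open>strong_law_of_large_numbers\<close>): nonnegative variables are truncated and treated with
Chebyshev's inequality and Borel--Cantelli along the geometric sequence \<open>\<lceil>\<alpha>\<^sup>n\<rceil>\<close>, and monotonicity of
the partial sums fills the gaps as \<open>\<alpha>\<close> decreases to 1.\<close>

section \<open>The strong law of large numbers\<close>

text \<open>The two halves of one estimate. If \<open>\<alpha>\<^sup>p\<close> is the first power at or above \<open>x\<close>, the first sum is a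
geometric series starting with \<open>x\<^sup>2 / \<alpha>\<^sup>p \<le> x\<close> and decreasing, the second a geometric series
ending below \<open>x\<close> and increasing; both are therefore of order \<open>x\<close>, uniformly in the number of
terms. Integrated against the law of a variable, the left sides become scaled truncated second
moments and scaled tail probabilities, and a first moment alone suffices to sum them. The inductions
carry the remainder of the geometric series, because the plain bound is not inductive.\<close>

lemma truncated_geometric_sums:
  fixes \<alpha> x :: real
  assumes \<alpha>: "1 < \<alpha>" and x: "0 \<le> x"
  shows "(\<Sum>n<N. (x * indicator {..\<alpha> ^ n} x)\<^sup>2 / \<alpha> ^ n) \<le> \<alpha> / (\<alpha> - 1) * x"
    and "(\<Sum>n<N. \<alpha> ^ n * indicator {\<alpha> ^ n<..} x) \<le> \<alpha> / (\<alpha> - 1) * x"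
proof -
  have pos: "0 < \<alpha> ^ n" for n using \<alpha> by simp
  have "(\<Sum>n<N. (x * indicator {..\<alpha> ^ n} x)\<^sup>2 / \<alpha> ^ n)
      \<le> \<alpha> / (\<alpha> - 1) * x - \<alpha> / (\<alpha> - 1) * x * min 1 (x / \<alpha> ^ N)"
  proof (induction N)
    case 0
    have "x * min 1 x \<le> x * 1" using x by (intro mult_left_mono) auto
    then have "\<alpha> / (\<alpha> - 1) * (x * min 1 x) \<le> \<alpha> / (\<alpha> - 1) * (x * 1)"
      by (rule mult_left_mono) (use \<alpha> in simp)
    then show ?case by (simp add: mult.assoc)
  next
    case (Suc N)
    show ?case
    proof (cases "x \<le> \<alpha> ^ N")
      case True
      moreover have "\<alpha> ^ N \<le> \<alpha> ^ Suc N" using \<alpha> by simp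
      ultimately have "x / \<alpha> ^ N \<le> 1" "x / \<alpha> ^ Suc N \<le> 1" using pos[of N] pos[of "Suc N"] by (auto simp: divide_le_eq_1 simp del: power_Suc)
      moreover have "\<alpha> / (\<alpha> - 1) * x * (x / \<alpha> ^ N) = x\<^sup>2 / \<alpha> ^ N + \<alpha> / (\<alpha> - 1) * x * (x / \<alpha> ^ Suc N)"
        using \<alpha> by (simp add: field_simps power2_eq_square)
      ultimately show ?thesis
        using Suc True by (simp only: min_absorb2 sum.lessThan_Suc) (simp del: power_Suc)
    next
      case False
      have "\<alpha> / (\<alpha> - 1) * x * min 1 (x / \<alpha> ^ Suc N) \<le> \<alpha> / (\<alpha> - 1) * x * min 1 (x / \<alpha> ^ N)"
        using False \<alpha> pos[of N] x by (intro mult_left_mono) (auto simp: min_def)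
      then show ?thesis using Suc False by (simp del: power_Suc)
    qed
  qed
  also have "\<dots> \<le> \<alpha> / (\<alpha> - 1) * x"
    using \<alpha> x pos[of N] by simp
  finally show "(\<Sum>n<N. (x * indicator {..\<alpha> ^ n} x)\<^sup>2 / \<alpha> ^ n) \<le> \<alpha> / (\<alpha> - 1) * x" .
  have "(\<Sum>n<N. \<alpha> ^ n * indicator {\<alpha> ^ n<..} x) \<le> min (\<alpha> * x) (\<alpha> ^ N) / (\<alpha> - 1)"
  proof (induction N)
    case 0
    show ?case using x \<alpha> by simp
  next
    case (Suc N)
    show ?case
    proof (cases "\<alpha> ^ N < x")
      case True
      have "(\<Sum>n<N. \<alpha> ^ n * indicator {\<alpha> ^ n<..} x) \<le> \<alpha> ^ N / (\<alpha> - 1)"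
        using \<alpha> by (intro order_trans[OF Suc.IH] divide_right_mono) auto
      moreover have "\<alpha> ^ N / (\<alpha> - 1) + \<alpha> ^ N = \<alpha> ^ Suc N / (\<alpha> - 1)"
        using \<alpha> by (simp add: field_simps)
      moreover have "\<alpha> ^ Suc N \<le> \<alpha> * x" using True \<alpha> by simp
      ultimately show ?thesis using True by (simp add: min_def del: power_Suc)
    next
      case False
      have "min (\<alpha> * x) (\<alpha> ^ N) / (\<alpha> - 1) \<le> min (\<alpha> * x) (\<alpha> ^ Suc N) / (\<alpha> - 1)"
        using \<alpha> by (intro divide_right_mono min.mono) auto
      then show ?thesis using Suc False by (simp del: power_Suc)
    qed
  qed
  also have "\<dots> \<le> \<alpha> / (\<alpha> - 1) * x"
    using \<alpha> by (auto simp: divide_simps)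
  finally show "(\<Sum>n<N. \<alpha> ^ n * indicator {\<alpha> ^ n<..} x) \<le> \<alpha> / (\<alpha> - 1) * x" .
qed

text \<open>For \<open>\<alpha>\<^sup>n \<le> N < \<alpha> ^ (n + 1)\<close>, monotonicity of \<open>s\<close> encloses \<open>s N / N\<close> between the averages at
\<open>\<lceil>\<alpha>\<^sup>n\<rceil>\<close> and \<open>\<lceil>\<alpha> ^ (n + 1)\<rceil>\<close> up to a factor that tends to \<open>\<alpha>\<close>. Letting \<open>\<alpha>\<close> decrease to 1 closes
the gap; the values \<open>\<alpha> = 1 + 1 / (j + 1)\<close> keep the hypothesis countable, so that it can hold
almost surely for all of them together.\<close>

lemma average_tendsto_from_geometric_subsequences:
  fixes s :: "nat \<Rightarrow> real"
  assumes mono: "mono s" and nonneg: "\<And>n. 0 \<le> s n"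
    and sub: "\<And>j::nat. (\<lambda>n. s (nat \<lceil>(1 + 1 / Suc j) ^ n\<rceil>) / nat \<lceil>(1 + 1 / Suc j) ^ n\<rceil>) \<longlonglongrightarrow> m"
  shows "(\<lambda>N. s N / N) \<longlonglongrightarrow> m"
proof -
  have approx: "\<exists>j. c * (1 + 1 / Suc j) < d" if "c < d" for c d :: real
  proof -
    have "(\<lambda>j. c * (1 + 1 / real (Suc j))) \<longlonglongrightarrow> c * (1 + 0)"
      by (intro tendsto_intros LIMSEQ_Suc[OF lim_1_over_n])
    then have "\<forall>\<^sub>F j in sequentially. c * (1 + 1 / real (Suc j)) < d"
      using that by (intro order_tendstoD(2)) auto
    then show ?thesis by (auto simp: eventually_sequentially)
  qed
  have bracket: "\<exists>r. filterlim r at_top sequentially \<and> (\<forall>\<^sub>F N in sequentially. \<alpha> ^ r N \<le> real N \<and> real N < \<alpha> ^ Suc (r N))"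
    if \<alpha>: "1 < \<alpha>" for \<alpha> :: real
  proof (rule exI[of _ "\<lambda>N. nat \<lfloor>log \<alpha> (real N)\<rfloor>"], rule conjI)
    have "filterlim (\<lambda>N. log \<alpha> (real N)) at_top sequentially"
      using filterlim_tendsto_pos_mult_at_top[OF tendsto_const _
        filterlim_compose[OF ln_at_top filterlim_real_sequentially], of "1 / ln \<alpha>"] \<alpha>
      by (simp add: log_def)
    then show "filterlim (\<lambda>N. nat \<lfloor>log \<alpha> (real N)\<rfloor>) at_top sequentially"
      by (intro filterlim_compose[OF filterlim_nat_sequentially] filterlim_compose[OF filterlim_floor_sequentially])
    show "\<forall>\<^sub>F N in sequentially. \<alpha> ^ (nat \<lfloor>log \<alpha> N\<rfloor>) \<le> real N \<and> real N < \<alpha> ^ Suc (nat \<lfloor>log \<alpha> N\<rfloor>)"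
      using eventually_ge_at_top[of 1]
    proof eventually_elim
      case (elim N)
      have l: "0 \<le> log \<alpha> N" using elim \<alpha> by simp
      have "\<alpha> ^ nat \<lfloor>log \<alpha> N\<rfloor> \<le> \<alpha> powr log \<alpha> N"
        using \<alpha> l by (subst powr_realpow[symmetric]) (auto intro!: powr_mono)
      moreover have "\<alpha> powr log \<alpha> N < \<alpha> ^ Suc (nat \<lfloor>log \<alpha> N\<rfloor>)"
        using \<alpha> l by (subst powr_realpow[symmetric]) (auto intro!: powr_less_mono, linarith)
      ultimately show ?case using elim \<alpha> by simp
    qed
  qed
  show ?thesis
  proof (rule order_tendstoI)
    fix c assume c: "c < m"
    show "\<forall>\<^sub>F N in sequentially. c < s N / real N"
    proof (cases "c < 0")
      case True
      then show ?thesis using nonneg by (intro always_eventually allI) (meson divide_nonneg_nonneg less_le_trans of_nat_0_le_iff)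
    next
      case False
      obtain d where d: "c < d" "d < m" using dense[OF c] by blast
      obtain j where j: "c * (1 + 1 / Suc j) < d" using approx[OF d(1)] by blast
      define \<alpha> where "\<alpha> = 1 + 1 / real (Suc j)"
      have \<alpha>: "1 < \<alpha>" by (simp add: \<alpha>_def)
      obtain r where r: "filterlim r at_top sequentially"
        "\<forall>\<^sub>F N in sequentially. \<alpha> ^ r N \<le> real N \<and> real N < \<alpha> ^ Suc (r N)" using bracket[OF \<alpha>] by blast
      have "\<forall>\<^sub>F n in sequentially. d < s (nat \<lceil>\<alpha> ^ n\<rceil>) / nat \<lceil>\<alpha> ^ n\<rceil>"
        using sub[of j] d(2) unfolding \<alpha>_def[symmetric] by (rule order_tendstoD)
      then have "\<forall>\<^sub>F N in sequentially. d < s (nat \<lceil>\<alpha> ^ r N\<rceil>) / nat \<lceil>\<alpha> ^ r N\<rceil>"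
        using r(1) by (rule eventually_compose_filterlim)
      then show ?thesis using r(2)
      proof eventually_elim
        case (elim N)
        define k where "k = nat \<lceil>\<alpha> ^ r N\<rceil>"
        have p: "0 < \<alpha> ^ r N" using \<alpha> by simp
        have k: "\<alpha> ^ r N \<le> real k" unfolding k_def by (simp add: real_nat_ceiling_ge)
        have kN: "k \<le> N" unfolding k_def using elim(2) by (simp add: ceiling_le_iff nat_le_iff)
        have k0: "0 < real k" using p k by linarith
        have N0: "0 < real N" using kN k0 by linarith
        have "c * N \<le> c * (\<alpha> * k)"
        proof (rule mult_left_mono)
          have "real N \<le> \<alpha> * \<alpha> ^ r N" using elim(2) by simp
          also have "\<dots> \<le> \<alpha> * k" using k \<alpha> by simp
          finally show "real N \<le> \<alpha> * k" .
        qed (use False in simp)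
        also have "\<dots> < d * k" using j k0 unfolding \<alpha>_def[symmetric] by simp
        also have "\<dots> < s k" using elim(1) k0 unfolding k_def[symmetric] by (simp add: less_divide_eq)
        also have "\<dots> \<le> s N" using mono kN by (rule monoD)
        finally show ?case using N0 by (simp add: less_divide_eq)
      qed
    qed
  next
    fix c assume c: "m < c"
    have "0 \<le> m" using sub[of 0] by (rule LIMSEQ_le_const) (use nonneg in auto)
    obtain d where d: "m < d" "d < c" using dense[OF c] by blast
    have d0: "0 < d" using d \<open>0 \<le> m\<close> by linarith
    obtain j where j: "d * (1 + 1 / Suc j) < c" using approx[OF d(2)] by blast
    define \<alpha> where "\<alpha> = 1 + 1 / real (Suc j)"
    have \<alpha>: "1 < \<alpha>" by (simp add: \<alpha>_def)
    obtain r where r: "filterlim r at_top sequentially"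
      "\<forall>\<^sub>F N in sequentially. \<alpha> ^ r N \<le> real N \<and> real N < \<alpha> ^ Suc (r N)" using bracket[OF \<alpha>] by blast
    have "(\<lambda>N. d * (\<alpha> + 1 / real N)) \<longlonglongrightarrow> d * (\<alpha> + 0)"
      by (intro tendsto_intros lim_1_over_n)
    then have small: "\<forall>\<^sub>F N in sequentially. d * (\<alpha> + 1 / real N) < c"
      using j unfolding \<alpha>_def[symmetric] by (intro order_tendstoD(2)) auto
    have "\<forall>\<^sub>F n in sequentially. s (nat \<lceil>\<alpha> ^ n\<rceil>) / nat \<lceil>\<alpha> ^ n\<rceil> < d"
      using sub[of j] d(1) unfolding \<alpha>_def[symmetric] by (rule order_tendstoD)
    moreover have "filterlim (\<lambda>N. Suc (r N)) at_top sequentially"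
      using r(1) by (rule filterlim_compose[OF filterlim_Suc])
    ultimately have "\<forall>\<^sub>F N in sequentially. s (nat \<lceil>\<alpha> ^ Suc (r N)\<rceil>) / nat \<lceil>\<alpha> ^ Suc (r N)\<rceil> < d"
      by (rule eventually_compose_filterlim)
    then show "\<forall>\<^sub>F N in sequentially. s N / real N < c" using r(2) small eventually_gt_at_top[of 0]
    proof eventually_elim
      case (elim N)
      define k where "k = nat \<lceil>\<alpha> ^ Suc (r N)\<rceil>"
      have p: "0 < \<alpha> ^ Suc (r N)" using \<alpha> by simp
      have k: "\<alpha> ^ Suc (r N) \<le> real k" unfolding k_def by (simp add: real_nat_ceiling_ge)
      have k2: "real k \<le> \<alpha> ^ Suc (r N) + 1" unfolding k_def using p by linarith
      have N0: "0 < real N" using elim by simp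
      have "real N < real k" using elim(2) k by linarith
      then have "s N \<le> s k" using mono by (auto intro: monoD)
      also have "\<dots> < d * k" using elim(1) \<open>real N < real k\<close> N0 unfolding k_def[symmetric] by (simp add: divide_less_eq)
      also have "\<dots> \<le> d * (\<alpha> * N + 1)"
      proof (rule mult_left_mono)
        have "\<alpha> ^ Suc (r N) \<le> \<alpha> * N" using elim(2) \<alpha> by simp
        then show "real k \<le> \<alpha> * N + 1" using k2 by linarith
      qed (use d0 in simp)
      also have "\<dots> = d * (\<alpha> + 1 / N) * N" using N0 by (simp add: field_simps)
      also have "\<dots> < c * N" using elim(3) N0 by simp
      finally show ?case using N0 by (simp add: divide_less_eq)
    qed
  qed
qed

lemma (in prob_space) expectation_sum_square_indep:
  fixes Z :: "'i \<Rightarrow> 'a \<Rightarrow> real"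
  assumes "finite I" and "indep_vars (\<lambda>_. borel) Z I"
    and "\<And>i. i \<in> I \<Longrightarrow> integrable M (\<lambda>\<omega>. (Z i \<omega>)\<^sup>2)"
    and "\<And>i. i \<in> I \<Longrightarrow> expectation (Z i) = 0"
  shows "integrable M (\<lambda>\<omega>. (\<Sum>i\<in>I. Z i \<omega>)\<^sup>2) \<and>
    expectation (\<lambda>\<omega>. (\<Sum>i\<in>I. Z i \<omega>)\<^sup>2) = (\<Sum>i\<in>I. expectation (\<lambda>\<omega>. (Z i \<omega>)\<^sup>2))"
  using assms
proof (induction I)
  case empty
  then show ?case by simp
next
  case (insert i I)
  let ?S = "\<lambda>\<omega>. \<Sum>i\<in>I. Z i \<omega>"
  have rv: "random_variable borel (Z j)" if "j \<in> insert i I" for j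
    using insert.prems(1) that by (auto simp: indep_vars_def)
  have int: "integrable M (Z j)" if "j \<in> insert i I" for j
    using square_integrable_imp_integrable[OF rv[OF that] insert.prems(2)[OF that]] .
  have indep: "indep_var borel (Z i) borel ?S"
    using insert by (intro indep_vars_sum) auto
  have S: "integrable M ?S" "expectation ?S = 0"
    using int insert.prems(3) by (auto simp: Bochner_Integration.integral_sum)
  have IH: "integrable M (\<lambda>\<omega>. (?S \<omega>)\<^sup>2)"
    "expectation (\<lambda>\<omega>. (?S \<omega>)\<^sup>2) = (\<Sum>i\<in>I. expectation (\<lambda>\<omega>. (Z i \<omega>)\<^sup>2))"
    using insert.IH insert.prems indep_vars_subset[OF insert.prems(1)] by auto
  have prod: "integrable M (\<lambda>\<omega>. Z i \<omega> * ?S \<omega>)" "expectation (\<lambda>\<omega>. Z i \<omega> * ?S \<omega>) = 0"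
    using indep_var_integrable[OF indep] indep_var_lebesgue_integral[OF indep] int S insert.prems(3) by auto
  have eq: "(\<lambda>\<omega>. (\<Sum>i\<in>insert i I. Z i \<omega>)\<^sup>2) = (\<lambda>\<omega>. (Z i \<omega>)\<^sup>2 + 2 * (Z i \<omega> * ?S \<omega>) + (?S \<omega>)\<^sup>2)"
    using insert.hyps by (simp add: power2_sum algebra_simps)
  show ?case
    unfolding eq using prod IH insert.prems(2)[of i] insert.hyps by simp
qed


lemma (in prob_space) expectation_eq_of_identically_distributed:
  assumes rv: "\<And>i. i \<ge> (1::nat) \<Longrightarrow> random_variable borel (Y i)"
    and ident: "\<And>i. i \<ge> 1 \<Longrightarrow> distr M borel (Y i) = distr M borel (Y 1)"
    and f: "f \<in> borel_measurable borel" and i: "i \<ge> 1"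
  shows "expectation (\<lambda>\<omega>. f (Y i \<omega>)) = (expectation (\<lambda>\<omega>. f (Y 1 \<omega>)) :: real)"
proof -
  have "expectation (\<lambda>\<omega>. f (Y j \<omega>)) = integral\<^sup>L (distr M borel (Y j)) f" if "j \<ge> 1" for j
    using rv[OF that] f by (simp add: integral_distr)
  from this[of i] this[of 1] show ?thesis using ident[OF i] i by simp
qed

text \<open>Replace each \<open>Y i\<close> by its truncation at level \<open>a\<close>, where \<open>a\<close> and the number \<open>k\<close> of summands are
comparable. Either some truncation changes a value, which by the union bound costs at most
\<open>k\<close> times the tail probability beyond \<open>a\<close>, or Chebyshev's inequality applies to the truncated
sum, whose variance is at most \<open>k\<close> times the truncated second moment. Both terms are expressed
through \<open>Y 1\<close> and \<open>a\<close> in the form summed by the geometric estimate above.\<close>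

lemma (in prob_space) average_deviation_bound:
  fixes Y :: "nat \<Rightarrow> 'a \<Rightarrow> real"
  assumes indep: "indep_vars (\<lambda>_. borel) Y {1..}"
    and ident: "\<And>i. i \<ge> 1 \<Longrightarrow> distr M borel (Y i) = distr M borel (Y 1)"
    and nonneg: "\<And>i \<omega>. i \<ge> 1 \<Longrightarrow> 0 \<le> Y i \<omega>"
    and a: "0 < a" "a \<le> real k" "real k \<le> 2 * a" and \<epsilon>: "0 < \<epsilon>"
  shows "prob {\<omega> \<in> space M. \<epsilon> \<le> \<bar>(\<Sum>i=1..k. Y i \<omega>) / k - expectation (\<lambda>\<omega>. Y 1 \<omega> * indicator {..a} (Y 1 \<omega>))\<bar>}
    \<le> expectation (\<lambda>\<omega>. (Y 1 \<omega> * indicator {..a} (Y 1 \<omega>))\<^sup>2 / a) / \<epsilon>\<^sup>2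
      + 2 * expectation (\<lambda>\<omega>. a * indicator {a<..} (Y 1 \<omega>))"
    (is "prob ?A \<le> _")
proof -
  have rv[measurable]: "random_variable borel (Y i)" if "i \<ge> 1" for i
    using indep that by (auto simp: indep_vars_def)
  define f where "f x = x * indicat_real {..a} x" for x
  have f[measurable]: "f \<in> borel_measurable borel" unfolding f_def by measurable
  have fb: "\<bar>f (Y i \<omega>)\<bar> \<le> a" if "i \<ge> 1" for i \<omega>
    using nonneg[OF that] a by (auto simp: f_def indicator_def)
  define c where "c = expectation (\<lambda>\<omega>. f (Y 1 \<omega>))"
  define Z where "Z i \<omega> = f (Y i \<omega>) - c" for i \<omega>
  have k: "0 < real k" using a by linarith
  have rvf: "random_variable borel (\<lambda>\<omega>. f (Y i \<omega>))" if "i \<ge> 1" for i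
    using rv[OF that] f by (rule measurable_compose)
  have int_f: "integrable M (\<lambda>\<omega>. f (Y i \<omega>))" if "i \<ge> 1" for i
    using fb[OF that] rvf[OF that] by (intro integrable_const_bound[where B=a]) auto
  have int_f2: "integrable M (\<lambda>\<omega>. (f (Y i \<omega>))\<^sup>2)" if "i \<ge> 1" for i
  proof (rule integrable_const_bound[where B="a\<^sup>2"])
    show "AE \<omega> in M. norm ((f (Y i \<omega>))\<^sup>2) \<le> a\<^sup>2"
      using fb[OF that] a by (auto simp: abs_le_square_iff[symmetric])
  qed (use rvf[OF that] in simp)
  have same: "expectation (\<lambda>\<omega>. g (Y i \<omega>)) = expectation (\<lambda>\<omega>. g (Y 1 \<omega>))"
    if "i \<ge> 1" "g \<in> borel_measurable borel" for i and g :: "real \<Rightarrow> real"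
    using rv ident that(2,1) by (rule expectation_eq_of_identically_distributed)
  have int_Z: "integrable M (\<lambda>\<omega>. (Z i \<omega>)\<^sup>2)" if "i \<in> {1..k}" for i
    unfolding Z_def power2_diff using int_f[of i] int_f2[of i] that by auto
  have indep_Z: "indep_vars (\<lambda>_. borel) Z {1..k}"
    unfolding Z_def by (rule indep_vars_compose2[OF indep_vars_subset[OF indep]]) auto
  have mean_Z: "expectation (Z i) = 0" if "i \<in> {1..k}" for i
    unfolding Z_def using that same[of i f] int_f[of i] by (simp add: prob_space c_def)
  note sq = expectation_sum_square_indep[OF finite_atLeastAtMost indep_Z int_Z mean_Z]
  have var: "expectation (\<lambda>\<omega>. (Z i \<omega>)\<^sup>2) \<le> expectation (\<lambda>\<omega>. (f (Y 1 \<omega>))\<^sup>2)" if "i \<in> {1..k}" for i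
  proof -
    have "expectation (\<lambda>\<omega>. (Z i \<omega>)\<^sup>2) = expectation (\<lambda>\<omega>. (f (Y 1 \<omega>) - c)\<^sup>2)"
      unfolding Z_def using that by (intro same) auto
    also have "\<dots> = expectation (\<lambda>\<omega>. (f (Y 1 \<omega>))\<^sup>2) - c\<^sup>2"
      unfolding c_def using int_f int_f2 by (intro variance_eq) auto
    finally show ?thesis by simp
  qed
  define B where "B = {\<omega> \<in> space M. \<epsilon> * k \<le> \<bar>\<Sum>i=1..k. Z i \<omega>\<bar>}"
  define C where "C i = {\<omega> \<in> space M. a < Y i \<omega>}" for i
  have Zm: "random_variable borel (\<lambda>\<omega>. \<Sum>i=1..k. Z i \<omega>)"
    unfolding Z_def by (intro borel_measurable_sum borel_measurable_diff rvf) auto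
  have B: "B \<in> events" unfolding B_def using Zm by measurable
  have C: "C i \<in> events" if "i \<in> {1..k}" for i
    unfolding C_def using rv[of i] that by (simp add: borel_measurable_iff_greater)
  have "?A \<subseteq> B \<union> (\<Union>i\<in>{1..k}. C i)"
  proof
    fix \<omega> assume \<omega>: "\<omega> \<in> ?A"
    show "\<omega> \<in> B \<union> (\<Union>i\<in>{1..k}. C i)"
    proof (cases "\<exists>i\<in>{1..k}. a < Y i \<omega>")
      case True
      then show ?thesis using \<omega> by (auto simp: C_def)
    next
      case False
      have "(\<Sum>i=1..k. Z i \<omega>) = (\<Sum>i=1..k. Y i \<omega> - c)"
        using False by (intro sum.cong) (auto simp: Z_def f_def not_less)
      also have "\<dots> = k * ((\<Sum>i=1..k. Y i \<omega>) / k - c)"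
        using k by (simp add: sum_subtractf field_simps)
      finally have "\<bar>\<Sum>i=1..k. Z i \<omega>\<bar> = k * \<bar>(\<Sum>i=1..k. Y i \<omega>) / k - c\<bar>"
        by (simp add: abs_mult)
      moreover have "\<epsilon> \<le> \<bar>(\<Sum>i=1..k. Y i \<omega>) / k - c\<bar>" using \<omega> by (simp add: c_def f_def)
      ultimately show ?thesis using \<omega> k by (simp add: B_def mult.commute)
    qed
  qed
  then have "prob ?A \<le> prob (B \<union> (\<Union>i\<in>{1..k}. C i))"
    using B C by (intro finite_measure_mono) auto
  also have "\<dots> \<le> prob B + prob (\<Union>i\<in>{1..k}. C i)"
    using B C by (intro measure_Un_le) auto
  also have "prob (\<Union>i\<in>{1..k}. C i) \<le> (\<Sum>i=1..k. prob (C i))"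
    using C by (intro finite_measure_subadditive_finite) auto
  finally have union: "prob ?A \<le> prob B + (\<Sum>i=1..k. prob (C i))" by simp
  have "prob B \<le> expectation (\<lambda>\<omega>. (\<Sum>i=1..k. Z i \<omega>)\<^sup>2) / (\<epsilon> * k)\<^sup>2"
    unfolding B_def using Zm sq k \<epsilon> by (intro second_moment_method) auto
  also have "\<dots> \<le> k * expectation (\<lambda>\<omega>. (f (Y 1 \<omega>))\<^sup>2) / (\<epsilon> * k)\<^sup>2"
    using sq sum_mono[of "{1..k}", OF var] by (intro divide_right_mono) auto
  also have "\<dots> = expectation (\<lambda>\<omega>. (f (Y 1 \<omega>))\<^sup>2) / k / \<epsilon>\<^sup>2"
    using k by (simp add: field_simps power2_eq_square)
  also have "\<dots> \<le> expectation (\<lambda>\<omega>. (f (Y 1 \<omega>))\<^sup>2) / a / \<epsilon>\<^sup>2"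
    using a k by (intro divide_right_mono divide_left_mono) auto
  finally have B_le: "prob B \<le> expectation (\<lambda>\<omega>. (f (Y 1 \<omega>))\<^sup>2 / a) / \<epsilon>\<^sup>2" by simp
  have "prob (C i) = expectation (\<lambda>\<omega>. indicator {a<..} (Y 1 \<omega>))" if i: "i \<in> {1..k}" for i
  proof -
    have "prob (C i) = expectation (indicat_real (C i))" using C[OF i] by simp
    also have "\<dots> = expectation (\<lambda>\<omega>. indicator {a<..} (Y i \<omega>))"
      by (intro Bochner_Integration.integral_cong) (auto simp: C_def indicator_def)
    also have "\<dots> = expectation (\<lambda>\<omega>. indicator {a<..} (Y 1 \<omega>))" using i by (intro same) auto
    finally show ?thesis .
  qed
  then have "(\<Sum>i=1..k. prob (C i)) = k * expectation (\<lambda>\<omega>. indicator {a<..} (Y 1 \<omega>))" by simp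
  also have "\<dots> \<le> 2 * a * expectation (\<lambda>\<omega>. indicator {a<..} (Y 1 \<omega>))"
    using a by (intro mult_right_mono) auto
  finally have C_le: "(\<Sum>i=1..k. prob (C i)) \<le> 2 * expectation (\<lambda>\<omega>. a * indicator {a<..} (Y 1 \<omega>))"
    by simp
  show ?thesis using union B_le C_le unfolding f_def by linarith
qed

text \<open>With truncation level \<open>\<alpha>\<^sup>n\<close> the deviation probabilities are summable in \<open>n\<close>, so by
Borel--Cantelli the averages along \<open>\<lceil>\<alpha>\<^sup>n\<rceil>\<close> stay close to the truncated means, and these
converge to the mean by dominated convergence.\<close>

lemma (in prob_space) strong_law_geometric_subsequence:
  fixes Y :: "nat \<Rightarrow> 'a \<Rightarrow> real" and \<alpha> :: real
  assumes indep: "indep_vars (\<lambda>_. borel) Y {1..}"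
    and ident: "\<And>i. i \<ge> 1 \<Longrightarrow> distr M borel (Y i) = distr M borel (Y 1)"
    and nonneg: "\<And>i \<omega>. i \<ge> 1 \<Longrightarrow> 0 \<le> Y i \<omega>"
    and int: "integrable M (Y 1)" and \<alpha>: "1 < \<alpha>"
  shows "AE \<omega> in M. (\<lambda>n. (\<Sum>i=1..nat \<lceil>\<alpha> ^ n\<rceil>. Y i \<omega>) / nat \<lceil>\<alpha> ^ n\<rceil>) \<longlonglongrightarrow> expectation (Y 1)"
proof -
  have rv[measurable]: "random_variable borel (Y i)" if "i \<ge> 1" for i
    using indep that by (auto simp: indep_vars_def)
  define k where "k n = nat \<lceil>\<alpha> ^ n\<rceil>" for n
  define t where "t n \<omega> = Y 1 \<omega> * indicator {..\<alpha> ^ n} (Y 1 \<omega>)" for n \<omega>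
  define c where "c n = expectation (t n)" for n
  have \<alpha>1: "1 \<le> \<alpha> ^ n" for n using \<alpha> by (simp add: one_le_power)
  have \<alpha>0: "0 < \<alpha> ^ n" for n using \<alpha> by simp
  have k: "\<alpha> ^ n \<le> k n" "k n \<le> 2 * \<alpha> ^ n" for n
    using \<alpha>1[of n] unfolding k_def by linarith+
  have tm[measurable]: "random_variable borel (t n)" for n unfolding t_def by measurable
  have c: "c \<longlonglongrightarrow> expectation (Y 1)"
    unfolding c_def
  proof (rule integral_dominated_convergence[where w="Y 1"])
    show "AE \<omega> in M. (\<lambda>n. t n \<omega>) \<longlonglongrightarrow> Y 1 \<omega>"
    proof (rule AE_I2)
      fix \<omega>
      have "\<forall>\<^sub>F n in sequentially. Y 1 \<omega> \<le> \<alpha> ^ n"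
        using real_arch_pow[OF \<alpha>, of "Y 1 \<omega>"] \<alpha>
        by (metis (no_types, lifting) eventually_sequentially less_imp_le order_less_le_trans power_increasing)
      then show "(\<lambda>n. t n \<omega>) \<longlonglongrightarrow> Y 1 \<omega>"
        by (intro tendsto_eventually, elim eventually_mono) (simp add: t_def)
    qed
    show "AE \<omega> in M. norm (t n \<omega>) \<le> Y 1 \<omega>" for n
      using nonneg[of 1] by (auto simp: t_def indicator_def)
  qed (use int in auto)
  have int_t2: "integrable M (\<lambda>\<omega>. (t n \<omega>)\<^sup>2)" for n
  proof (rule integrable_const_bound[where B="(\<alpha> ^ n)\<^sup>2"])
    show "AE \<omega> in M. norm ((t n \<omega>)\<^sup>2) \<le> (\<alpha> ^ n)\<^sup>2"
      using nonneg[of 1] \<alpha>0[of n] by (auto simp: t_def indicator_def intro!: power_mono)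
  qed simp
  have int_tail: "integrable M (\<lambda>\<omega>. \<alpha> ^ n * indicator {\<alpha> ^ n<..} (Y 1 \<omega>))" for n
    using \<alpha>0[of n] by (intro integrable_const_bound[where B="\<alpha> ^ n"]) (auto simp: indicator_def)
  have summable: "summable (\<lambda>n. expectation (g n))"
    if g: "\<And>n. integrable M (g n)" "\<And>n \<omega>. 0 \<le> g n \<omega>"
      "\<And>N \<omega>. (\<Sum>n<N. g n \<omega>) \<le> \<alpha> / (\<alpha> - 1) * Y 1 \<omega>" for g
  proof (rule summableI_nonneg_bounded)
    show "0 \<le> expectation (g n)" for n using g(2) by (rule Bochner_Integration.integral_nonneg)
    show "(\<Sum>n<N. expectation (g n)) \<le> \<alpha> / (\<alpha> - 1) * expectation (Y 1)" for N
    proof -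
      have "(\<Sum>n<N. expectation (g n)) = expectation (\<lambda>\<omega>. \<Sum>n<N. g n \<omega>)"
        using g(1) by (simp add: Bochner_Integration.integral_sum)
      also have "\<dots> \<le> expectation (\<lambda>\<omega>. \<alpha> / (\<alpha> - 1) * Y 1 \<omega>)"
        using g int by (intro integral_mono) auto
      finally show ?thesis by simp
    qed
  qed
  have sum1: "summable (\<lambda>n. expectation (\<lambda>\<omega>. (t n \<omega>)\<^sup>2 / \<alpha> ^ n))"
    by (rule summable)
      (use int_t2 \<alpha>0 truncated_geometric_sums(1)[OF \<alpha> nonneg[of 1]] in \<open>auto simp: t_def less_imp_le\<close>)
  have sum2: "summable (\<lambda>n. expectation (\<lambda>\<omega>. \<alpha> ^ n * indicator {\<alpha> ^ n<..} (Y 1 \<omega>)))"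
    by (rule summable)
      (use int_tail \<alpha>0 truncated_geometric_sums(2)[OF \<alpha> nonneg[of 1]] in \<open>auto simp: less_imp_le\<close>)
  have "AE \<omega> in M. \<forall>\<^sub>F n in sequentially. \<bar>(\<Sum>i=1..k n. Y i \<omega>) / k n - c n\<bar> < \<epsilon>" if \<epsilon>: "0 < \<epsilon>" for \<epsilon>
  proof -
    define A where "A n = {\<omega> \<in> space M. \<epsilon> \<le> \<bar>(\<Sum>i=1..k n. Y i \<omega>) / k n - c n\<bar>}" for n
    have rvS: "random_variable borel (\<lambda>\<omega>. \<Sum>i=1..k n. Y i \<omega>)" for n by (intro borel_measurable_sum rv) auto
    have A: "A n \<in> events" for n unfolding A_def using rvS[of n] by measurable
    have "summable (\<lambda>n. prob (A n))"
    proof (rule summable_comparison_test_ev[rotated])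
      show "summable (\<lambda>n. expectation (\<lambda>\<omega>. (t n \<omega>)\<^sup>2 / \<alpha> ^ n) / \<epsilon>\<^sup>2
          + 2 * expectation (\<lambda>\<omega>. \<alpha> ^ n * indicator {\<alpha> ^ n<..} (Y 1 \<omega>)))"
        by (intro summable_add summable_divide summable_mult sum1 sum2)
      show "\<forall>\<^sub>F n in sequentially. norm (prob (A n)) \<le> expectation (\<lambda>\<omega>. (t n \<omega>)\<^sup>2 / \<alpha> ^ n) / \<epsilon>\<^sup>2
          + 2 * expectation (\<lambda>\<omega>. \<alpha> ^ n * indicator {\<alpha> ^ n<..} (Y 1 \<omega>))"
        unfolding A_def c_def t_def real_norm_def abs_of_nonneg[OF measure_nonneg]
        by (intro always_eventually allI average_deviation_bound indep ident nonneg \<alpha>0 k \<epsilon>)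
    qed
    then have "AE \<omega> in M. \<forall>\<^sub>F n in sequentially. \<omega> \<in> space M - A n"
      using A by (intro borel_cantelli_AE1) (auto simp: emeasure_eq_measure)
    then show ?thesis
      by eventually_elim (auto simp: A_def elim!: eventually_mono)
  qed
  then have "AE \<omega> in M. \<forall>j. \<forall>\<^sub>F n in sequentially. \<bar>(\<Sum>i=1..k n. Y i \<omega>) / k n - c n\<bar> < 1 / real (Suc j)"
    by (simp add: AE_all_countable)
  then show ?thesis
    unfolding k_def[symmetric]
  proof eventually_elim
    case (elim \<omega>)
    have "(\<lambda>n. (\<Sum>i=1..k n. Y i \<omega>) / k n - c n) \<longlonglongrightarrow> 0"
    proof (rule tendstoI)
      fix e :: real assume "0 < e"
      then obtain j where "1 / real (Suc j) < e" using nat_approx_posE by blast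
      then show "\<forall>\<^sub>F n in sequentially. dist ((\<Sum>i=1..k n. Y i \<omega>) / k n - c n) 0 < e"
        using elim[rule_format, of j] by (auto simp: dist_real_def elim!: eventually_mono)
    qed
    from tendsto_add[OF this c] show ?case by simp
  qed
qed

lemma (in prob_space) strong_law_of_large_numbers_nonneg:
  fixes Y :: "nat \<Rightarrow> 'a \<Rightarrow> real"
  assumes indep: "indep_vars (\<lambda>_. borel) Y {1..}"
    and ident: "\<And>i. i \<ge> 1 \<Longrightarrow> distr M borel (Y i) = distr M borel (Y 1)"
    and nonneg: "\<And>i \<omega>. i \<ge> 1 \<Longrightarrow> 0 \<le> Y i \<omega>"
    and int: "integrable M (Y 1)"
  shows "AE \<omega> in M. (\<lambda>N. (\<Sum>i=1..N. Y i \<omega>) / N) \<longlonglongrightarrow> expectation (Y 1)"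
proof -
  have "AE \<omega> in M. \<forall>j::nat. (\<lambda>n. (\<Sum>i=1..nat \<lceil>(1 + 1 / Suc j) ^ n\<rceil>. Y i \<omega>) / nat \<lceil>(1 + 1 / Suc j) ^ n\<rceil>)
      \<longlonglongrightarrow> expectation (Y 1)"
    unfolding AE_all_countable
    by (intro allI strong_law_geometric_subsequence indep ident nonneg int) auto
  then show ?thesis
  proof eventually_elim
    case (elim \<omega>)
    show ?case
    proof (rule average_tendsto_from_geometric_subsequences)
      show "mono (\<lambda>N. \<Sum>i=1..N. Y i \<omega>)"
        using nonneg by (auto simp: mono_iff_le_Suc)
      show "0 \<le> (\<Sum>i=1..N. Y i \<omega>)" for N using nonneg by (intro sum_nonneg) auto
    qed (use elim in blast)
  qed
qed

text \<open>Positive and negative parts are again independent and identically distributed, and the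
nonnegative case applies to each.\<close>

theorem (in prob_space) strong_law_of_large_numbers:
  fixes Y :: "nat \<Rightarrow> 'a \<Rightarrow> real"
  assumes indep: "indep_vars (\<lambda>_. borel) Y {1..}"
    and ident: "\<And>i. i \<ge> 1 \<Longrightarrow> distr M borel (Y i) = distr M borel (Y 1)"
    and int: "integrable M (Y 1)"
  shows "AE \<omega> in M. (\<lambda>N. (\<Sum>i=1..N. Y i \<omega>) / N) \<longlonglongrightarrow> expectation (Y 1)"
proof -
  have rv: "random_variable borel (Y i)" if "i \<ge> 1" for i
    using indep that by (auto simp: indep_vars_def)
  have part: "AE \<omega> in M. (\<lambda>N. (\<Sum>i=1..N. max 0 (s * Y i \<omega>)) / N) \<longlonglongrightarrow> expectation (\<lambda>\<omega>. max 0 (s * Y 1 \<omega>))" for s :: real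
  proof (rule strong_law_of_large_numbers_nonneg)
    show "indep_vars (\<lambda>_. borel) (\<lambda>i \<omega>. max 0 (s * Y i \<omega>)) {1..}"
      by (rule indep_vars_compose2[OF indep]) auto
    show "distr M borel (\<lambda>\<omega>. max 0 (s * Y i \<omega>)) = distr M borel (\<lambda>\<omega>. max 0 (s * Y 1 \<omega>))" if "i \<ge> 1" for i
    proof -
      have "distr M borel (\<lambda>\<omega>. max 0 (s * Y j \<omega>)) = distr (distr M borel (Y j)) borel (\<lambda>x. max 0 (s * x))" if "j \<ge> 1" for j
        using rv[OF that] by (subst distr_distr) (auto simp: comp_def)
      from this[of i] this[of 1] show ?thesis using ident[OF that] that by simp
    qed
  qed (use int in auto)
  have split: "max 0 (1 * x) - max 0 (- 1 * x) = x" for x :: real by simp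
  show ?thesis using part[of 1] part[of "- 1"]
  proof eventually_elim
    case (elim \<omega>)
    have "(\<lambda>N. (\<Sum>i=1..N. max 0 (1 * Y i \<omega>)) / N - (\<Sum>i=1..N. max 0 (- 1 * Y i \<omega>)) / N)
        \<longlonglongrightarrow> expectation (\<lambda>\<omega>. max 0 (1 * Y 1 \<omega>)) - expectation (\<lambda>\<omega>. max 0 (- 1 * Y 1 \<omega>))"
      using elim by (rule tendsto_diff)
    moreover have "expectation (\<lambda>\<omega>. max 0 (1 * Y 1 \<omega>)) - expectation (\<lambda>\<omega>. max 0 (- 1 * Y 1 \<omega>)) = expectation (Y 1)"
      using int by (subst Bochner_Integration.integral_diff[symmetric])
        (auto simp: split[unfolded mult_1 mult_minus1])
    ultimately show ?case
      by (simp only: diff_divide_distrib[symmetric] sum_subtractf[symmetric] split)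
  qed
qed

section \<open>Convergence of volumes of convex sets\<close>

text \<open>Otherwise infinitely many \<open>L N\<close> could be separated from \<open>x\<close> by unit normals. A limit \<open>v\<close> of these
normals along a subsequence supports \<open>K\<close> at \<open>x\<close>, since every point of the dense set \<open>D\<close> is a
limit of points of \<open>L N\<close>; but no hyperplane supports \<open>K\<close> at an interior point.\<close>

lemma eventually_mem_of_interior:
  fixes K :: "'a::euclidean_space set" and L :: "nat \<Rightarrow> 'a set"
  assumes conv: "\<And>N. convex (L N)"
    and D: "D \<subseteq> K" "K \<subseteq> closure D"
    and inner: "\<And>d. d \<in> D \<Longrightarrow> \<exists>z. (\<forall>N. z N \<in> L N) \<and> z \<longlonglongrightarrow> d"
    and x: "x \<in> interior K"
  shows "\<forall>\<^sub>F N in sequentially. x \<in> L N"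
proof (rule ccontr)
  assume "\<not> (\<forall>\<^sub>F N in sequentially. x \<in> L N)"
  then have inf: "infinite {N. x \<notin> L N}"
    by (simp add: eventually_cofinite flip: cofinite_eq_sequentially)
  define q where "q = enumerate {N. x \<notin> L N}"
  have q: "strict_mono q" "\<And>i. x \<notin> L (q i)"
    using strict_mono_enumerate[OF inf] enumerate_in_set[OF inf] by (auto simp: q_def)
  have "\<exists>u. norm u = 1 \<and> (\<forall>z\<in>L (q i). 0 \<le> u \<bullet> (z - x))" for i
  proof -
    have "\<exists>u. u \<noteq> 0 \<and> (\<forall>y\<in>(\<lambda>z. z - x) ` L (q i). 0 \<le> u \<bullet> y)"
      using q(2)[of i] by (intro separating_hyperplane_set_0 convex_translation_subtract conv) auto
    then obtain u where "u \<noteq> 0" "\<forall>z\<in>L (q i). 0 \<le> u \<bullet> (z - x)" by auto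
    then show ?thesis by (intro exI[of _ "u /\<^sub>R norm u"]) auto
  qed
  then obtain u where u: "\<And>i. norm (u i) = 1" "\<And>i z. z \<in> L (q i) \<Longrightarrow> 0 \<le> u i \<bullet> (z - x)"
    by metis
  have "\<forall>i. u i \<in> sphere 0 1" using u(1) by simp
  then obtain v p where v: "v \<in> sphere 0 1" and p: "strict_mono (p :: nat \<Rightarrow> nat)" and lim: "(u \<circ> p) \<longlonglongrightarrow> v"
    using compact_imp_seq_compact[OF compact_sphere, of 0 1] unfolding seq_compact_def by metis
  have "0 \<le> v \<bullet> (d - x)" if d: "d \<in> D" for d
  proof -
    obtain z where z: "\<And>N. z N \<in> L N" "z \<longlonglongrightarrow> d" using inner[OF d] by blast
    have "(\<lambda>i. z (q (p i))) \<longlonglongrightarrow> d"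
      using LIMSEQ_subseq_LIMSEQ[OF z(2) strict_mono_o[OF q(1) p]] by (simp add: comp_def)
    then have "(\<lambda>i. (u \<circ> p) i \<bullet> (z (q (p i)) - x)) \<longlonglongrightarrow> v \<bullet> (d - x)"
      by (intro tendsto_intros lim)
    then show ?thesis
      by (rule LIMSEQ_le_const) (use u(2) z(1) in auto)
  qed
  then have "D \<subseteq> {y. v \<bullet> x \<le> v \<bullet> y}" by (auto simp: inner_diff_right)
  then have "closure D \<subseteq> {y. v \<bullet> x \<le> v \<bullet> y}"
    by (rule closure_minimal) (intro closed_Collect_le continuous_intros)
  then have half: "\<And>y. y \<in> K \<Longrightarrow> v \<bullet> x \<le> v \<bullet> y" using D by blast
  obtain e where e: "e > 0" "cball x e \<subseteq> K" using x by (auto simp: mem_interior_cball)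
  \<comment> \<open>Moving from \<open>x\<close> against \<open>v\<close> stays in \<open>K\<close> but leaves the half-space.\<close>
  have "x - e *\<^sub>R v \<in> K" using e v by (auto simp: dist_norm intro!: subsetD[OF e(2)])
  from half[OF this] e(1) v show False by (auto simp: inner_diff_right dot_square_norm)
qed

text \<open>A hyperplane separates \<open>x\<close> strictly from \<open>K\<close>. As \<open>K\<close> is bounded, separation survives a small
change of the normal, which can thus be taken from the dense set \<open>U\<close>, where the hypothesis
controls \<open>L N\<close>.\<close>

lemma eventually_not_mem_of_not_closure:
  fixes K :: "'a::euclidean_space set" and L :: "nat \<Rightarrow> 'a set"
  assumes K: "convex K" "bounded K"
    and U: "\<And>W. open W \<Longrightarrow> W \<noteq> {} \<Longrightarrow> \<exists>u\<in>U. u \<in> W"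
    and outer: "\<And>u b c. u \<in> U \<Longrightarrow> b < c \<Longrightarrow> (\<And>z. z \<in> K \<Longrightarrow> u \<bullet> z \<le> b) \<Longrightarrow>
      \<forall>\<^sub>F N in sequentially. \<forall>z\<in>L N. u \<bullet> z < c"
    and x: "x \<notin> closure K"
  shows "\<forall>\<^sub>F N in sequentially. x \<notin> L N"
proof -
  obtain a b where ab: "a \<bullet> x < b" "\<And>z. z \<in> closure K \<Longrightarrow> b < a \<bullet> z"
    using separating_hyperplane_closed_point[OF convex_closure[OF K(1)] closed_closure x] by blast
  obtain R where R: "R > 0" "\<And>z. z \<in> K \<Longrightarrow> norm z \<le> R" using K(2) by (auto simp: bounded_pos)
  \<comment> \<open>An error \<open>e\<close> in the normal shifts the values at \<open>x\<close> and on \<open>K\<close> by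
      at most \<open>e * norm x\<close> and \<open>e * R\<close>; together these must stay below the gap \<open>b - a \<bullet> x\<close>.\<close>
  define e where "e = (b - a \<bullet> x) / (2 * (R + norm x + 1))"
  have den: "0 < R + norm x + 1" using R(1) norm_ge_zero[of x] by linarith
  have e: "e > 0" using ab(1) den by (simp add: e_def)
  obtain u where u: "u \<in> U" "u \<in> ball (- a) e" using U[of "ball (- a) e"] e by auto
  then have ue: "norm (u + a) < e" by (simp add: dist_norm norm_minus_commute[of "- a"])
  have near: "\<bar>(u + a) \<bullet> y\<bar> \<le> e * norm y" for y
    using Cauchy_Schwarz_ineq2[of "u + a" y] ue by (meson less_imp_le mult_right_mono norm_ge_zero order_trans)
  have e2: "e * R + e * norm x < b - a \<bullet> x"
  proof -
    have "e * R + e * norm x < 2 * (e * (R + norm x + 1))" using e R(1) by (simp add: algebra_simps add_pos_nonneg add_nonneg_pos)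
    also have "\<dots> = b - a \<bullet> x" using den by (simp add: e_def divide_simps del: distrib_left_numeral)
    finally show ?thesis .
  qed
  have "\<forall>\<^sub>F N in sequentially. \<forall>z\<in>L N. u \<bullet> z < u \<bullet> x"
  proof (rule outer[OF u(1)])
    show "e * R - b < u \<bullet> x" using near[of x] e2 by (simp add: inner_add_left)
  next
    fix z assume z: "z \<in> K"
    have "b < a \<bullet> z" using ab(2) z closure_subset by blast
    moreover have "e * norm z \<le> e * R" using R(2)[OF z] e by simp
    ultimately show "u \<bullet> z \<le> e * R - b" using near[of z] by (simp add: inner_add_left)
  qed
  then show ?thesis by eventually_elim blast
qed

text \<open>Continuity of volume for convex sets, with both halves of the convergence tested on dense sets:
points of \<open>K\<close> from inside, directions from outside. This is what makes the criterion usable almost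
surely, since the dense sets can be chosen countable.
The indicator functions converge at every point off the frontier of \<open>K\<close>, which is
negligible because \<open>K\<close> is convex, and dominated convergence does the rest.\<close>

lemma convex_volume_tendsto:
  fixes K :: "'a::euclidean_space set" and L :: "nat \<Rightarrow> 'a set"
  assumes K: "convex K" "bounded K"
    and L: "\<And>N. convex (L N)" "\<And>N. L N \<subseteq> cball 0 R"
    and D: "D \<subseteq> K" "K \<subseteq> closure D"
    and inner: "\<And>d. d \<in> D \<Longrightarrow> \<exists>z. (\<forall>N. z N \<in> L N) \<and> z \<longlonglongrightarrow> d"
    and U: "\<And>W. open W \<Longrightarrow> W \<noteq> {} \<Longrightarrow> \<exists>u\<in>U. u \<in> W"
    and outer: "\<And>u b c. u \<in> U \<Longrightarrow> b < c \<Longrightarrow> (\<And>z. z \<in> K \<Longrightarrow> u \<bullet> z \<le> b) \<Longrightarrow>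
      \<forall>\<^sub>F N in sequentially. \<forall>z\<in>L N. u \<bullet> z < c"
  shows "(\<lambda>N. measure lebesgue (L N)) \<longlonglongrightarrow> measure lebesgue K"
proof -
  have Lm: "L N \<in> lmeasurable" for N
    using L by (meson measurable_convex bounded_cball bounded_subset)
  have Km: "K \<in> lmeasurable" using K by (rule measurable_convex)
  have "(\<lambda>N. \<integral>x. indicat_real (L N) x \<partial>lebesgue) \<longlonglongrightarrow> (\<integral>x. indicat_real K x \<partial>lebesgue)"
  proof (rule integral_dominated_convergence[where w = "indicat_real (cball 0 R)"])
    have "negligible (frontier K)" using K(1) by (rule negligible_convex_frontier)
    then have "AE x in lebesgue. x \<notin> frontier K"
      by (simp add: AE_not_in negligible_iff_null_sets)
    then show "AE x in lebesgue. (\<lambda>N. indicat_real (L N) x) \<longlonglongrightarrow> indicat_real K x"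
    proof eventually_elim
      case (elim x)
      then consider "x \<in> interior K" | "x \<notin> closure K" by (auto simp: frontier_def)
      then show ?case
      proof cases
        case 1
        have "\<forall>\<^sub>F N in sequentially. x \<in> L N"
          using L(1) D inner 1 by (rule eventually_mem_of_interior)
        then show ?thesis using 1 interior_subset[of K] by (intro tendsto_eventually) (auto elim!: eventually_mono)
      next
        case 2
        have "\<forall>\<^sub>F N in sequentially. x \<notin> L N"
          using K U outer 2 by (rule eventually_not_mem_of_not_closure)
        then show ?thesis using 2 closure_subset[of K] by (intro tendsto_eventually) (auto elim!: eventually_mono simp: indicator_def)
      qed
    qed
    show "integrable lebesgue (indicat_real (cball 0 R))"
      using lmeasurable_cball[of 0 R] by (intro integrable_real_indicator) (auto simp: fmeasurable_def)
    show "AE x in lebesgue. norm (indicat_real (L N) x) \<le> indicat_real (cball 0 R) x" for N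
      using L(2)[of N] by (intro always_eventually) (auto simp: indicator_def)
  qed (use Lm Km in \<open>auto intro: borel_measurable_indicator fmeasurableD\<close>)
  then show ?thesis using Lm Km by (simp add: fmeasurable_def)
qed

section \<open>Integrals against empirical measures\<close>

text \<open>For \<open>N = 0\<close> the set function is \<open>0 / 0 = 0\<close> in the extended nonnegative reals. This makes the
integral formula below valid for every \<open>N\<close>.\<close>

lemma empirical_measure_0: "empirical_measure 0 x = null_measure borel"
  by (rule measure_eqI) (auto simp: emeasure_empirical_measure)

lemma empirical_measure_eq_distr:
  assumes "1 \<le> N"
  shows "empirical_measure N x = distr (measure_pmf (pmf_of_set {1..N})) borel x"
proof (rule measure_eqI)
  fix A assume "A \<in> sets (empirical_measure N x)"
  then have A: "A \<in> sets borel" by simp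
  have "(\<Sum>i=1..N. emeasure (return borel (x i)) A) = (\<Sum>i=1..N. indicator (x -` A) i)"
    using A by (simp add: indicator_def)
  also have "\<dots> = of_nat (card ({1..N} \<inter> x -` A))"
    by (simp add: indicator_def sum.If_cases vimage_def Int_def)
  finally show "emeasure (empirical_measure N x) A = emeasure (distr (measure_pmf (pmf_of_set {1..N})) borel x) A"
    using A assms
    by (simp add: emeasure_empirical_measure emeasure_distr emeasure_pmf_of_set ennreal_of_nat_eq_real_of_nat divide_ennreal)
qed simp

lemma prob_space_empirical_measure:
  assumes "1 \<le> N" shows "prob_space (empirical_measure N x)"
  unfolding empirical_measure_eq_distr[OF assms] by (intro measure_pmf.prob_space_distr) simp

lemma integrable_empirical_measure:
  fixes f :: "'b::topological_space \<Rightarrow> 'c::{banach, second_countable_topology}"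
  assumes f: "f \<in> borel_measurable borel"
  shows "integrable (empirical_measure N x) f"
proof (cases "N = 0")
  case True
  then show ?thesis using f by (simp add: empirical_measure_0 integrable_iff_bounded)
next
  case False
  then show ?thesis
    using f by (simp add: empirical_measure_eq_distr integrable_distr_eq integrable_measure_pmf_finite)
qed

lemma integral_empirical_measure:
  fixes f :: "'b::topological_space \<Rightarrow> 'c::{banach, second_countable_topology}"
  assumes f: "f \<in> borel_measurable borel"
  shows "integral\<^sup>L (empirical_measure N x) f = (\<Sum>i=1..N. f (x i)) /\<^sub>R N"
proof (cases "N = 0")
  case True
  then show ?thesis by (simp add: empirical_measure_0)
next
  case False
  then have "integral\<^sup>L (empirical_measure N x) f = (\<integral>i. f (x i) \<partial>measure_pmf (pmf_of_set {1..N}))"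
    using f by (simp add: empirical_measure_eq_distr integral_distr)
  also have "\<dots> = (\<Sum>i=1..N. pmf (pmf_of_set {1..N}) i *\<^sub>R f (x i))"
    using False by (intro integral_measure_pmf) auto
  also have "\<dots> = (\<Sum>i=1..N. f (x i)) /\<^sub>R N"
    using False by (simp add: scaleR_sum_right inverse_eq_divide)
  finally show ?thesis .
qed

text \<open>The form in which the strong law is used: each coordinate of \<open>f (X i)\<close> is a real
sequence of independent, identically distributed integrable variables.\<close>

lemma (in prob_space) empirical_integral_tendsto:
  fixes X :: "nat \<Rightarrow> 'a \<Rightarrow> 'b::topological_space" and f :: "'b \<Rightarrow> 'c::euclidean_space"
  assumes indep: "indep_vars (\<lambda>_. borel) X {1..}"
    and law: "\<And>i. i \<ge> 1 \<Longrightarrow> distr M borel (X i) = \<mu>"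
    and f: "f \<in> borel_measurable borel" "integrable \<mu> f"
  shows "AE \<omega> in M. (\<lambda>N. integral\<^sup>L (empirical_measure N (\<lambda>i. X i \<omega>)) f) \<longlonglongrightarrow> integral\<^sup>L \<mu> f"
proof -
  have rv: "random_variable borel (X i)" if "i \<ge> 1" for i
    using indep that by (auto simp: indep_vars_def)
  have "AE \<omega> in M. \<forall>b\<in>Basis. (\<lambda>N. (\<Sum>i=1..N. f (X i \<omega>) \<bullet> b) / N) \<longlonglongrightarrow> integral\<^sup>L \<mu> f \<bullet> b"
  proof (rule AE_finite_allI)
    fix b :: 'c assume "b \<in> Basis"
    have g: "(\<lambda>x. f x \<bullet> b) \<in> borel_measurable borel" using f(1) by measurable
    have E: "expectation (\<lambda>\<omega>. f (X 1 \<omega>) \<bullet> b) = integral\<^sup>L \<mu> f \<bullet> b"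
    proof -
      have "integral\<^sup>L \<mu> f \<bullet> b = (\<integral>x. f x \<bullet> b \<partial>distr M borel (X 1))"
        using f(2) law[of 1] by simp
      then show ?thesis using g rv[of 1] by (simp add: integral_distr)
    qed
    show "AE \<omega> in M. (\<lambda>N. (\<Sum>i=1..N. f (X i \<omega>) \<bullet> b) / N) \<longlonglongrightarrow> integral\<^sup>L \<mu> f \<bullet> b"
      unfolding E[symmetric]
    proof (rule strong_law_of_large_numbers)
      show "indep_vars (\<lambda>_. borel) (\<lambda>i \<omega>. f (X i \<omega>) \<bullet> b) {1..}"
        by (rule indep_vars_compose2[OF indep g])
      have "distr M borel (\<lambda>\<omega>. f (X i \<omega>) \<bullet> b) = distr \<mu> borel (\<lambda>x. f x \<bullet> b)" if "i \<ge> 1" for i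
        unfolding law[OF that, symmetric] using rv[OF that] g by (subst distr_distr) (auto simp: comp_def)
      then show "distr M borel (\<lambda>\<omega>. f (X i \<omega>) \<bullet> b) = distr M borel (\<lambda>\<omega>. f (X 1 \<omega>) \<bullet> b)" if "i \<ge> 1" for i
        using that by simp
      have "integrable (distr M borel (X 1)) (\<lambda>x. f x \<bullet> b)" using f(2) law[of 1] by simp
      then show "integrable M (\<lambda>\<omega>. f (X 1 \<omega>) \<bullet> b)"
        using integrable_distr_eq[OF rv[of 1] g] by simp
    qed
  qed simp
  then show ?thesis
  proof eventually_elim
    case (elim \<omega>)
    then show ?case
      by (subst tendsto_componentwise_iff)
        (simp add: integral_empirical_measure[OF f(1)] inner_sum_left divide_inverse mult.commute)
  qed
qed

section \<open>Zonoids and their support functions\<close>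

lemma integrable_weight_scaleR:
  fixes \<nu> :: "(real ^ 'n::finite) measure"
  assumes \<nu>: "sets \<nu> = sets borel" "integrable \<nu> norm"
    and \<phi>: "\<phi> \<in> borel_measurable borel" "\<And>x. \<phi> x \<in> {0..1}"
  shows "integrable \<nu> (\<lambda>x. \<phi> x *\<^sub>R x)"
proof (rule Bochner_Integration.integrable_bound[OF \<nu>(2)])
  show "(\<lambda>x. \<phi> x *\<^sub>R x) \<in> borel_measurable \<nu>"
    using \<phi>(1) by (simp add: measurable_cong_sets[OF \<nu>(1) refl])
  show "AE x in \<nu>. norm (\<phi> x *\<^sub>R x) \<le> norm (norm x)"
    using \<phi>(2) by (intro always_eventually) (auto simp: mult_left_le_one_le)
qed

lemma integrable_ident:
  fixes \<nu> :: "(real ^ 'n::finite) measure"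
  assumes "sets \<nu> = sets borel" "integrable \<nu> norm"
  shows "integrable \<nu> (\<lambda>x. x)"
  using integrable_weight_scaleR[OF assms, of "\<lambda>_. 1"] by simp

lemma convex_zonoid:
  fixes \<nu> :: "(real ^ 'n::finite) measure"
  assumes \<nu>: "sets \<nu> = sets borel" "integrable \<nu> norm"
  shows "convex (zonoid \<nu>)"
proof (rule convexI)
  fix x y and s t :: real
  assume st: "0 \<le> s" "0 \<le> t" "s + t = 1" and "x \<in> zonoid \<nu>" "y \<in> zonoid \<nu>"
  then obtain \<phi> \<psi> where \<phi>: "\<phi> \<in> borel_measurable borel" "\<And>x. \<phi> x \<in> {0..1}" "x = (\<integral>x. \<phi> x *\<^sub>R x \<partial>\<nu>)"
    and \<psi>: "\<psi> \<in> borel_measurable borel" "\<And>x. \<psi> x \<in> {0..1}" "y = (\<integral>x. \<psi> x *\<^sub>R x \<partial>\<nu>)"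
    unfolding zonoid_def by blast
  have "s *\<^sub>R x + t *\<^sub>R y = (\<integral>x. (s * \<phi> x + t * \<psi> x) *\<^sub>R x \<partial>\<nu>)"
    using integrable_weight_scaleR[OF \<nu> \<phi>(1,2)] integrable_weight_scaleR[OF \<nu> \<psi>(1,2)]
    by (simp add: \<phi>(3) \<psi>(3) scaleR_add_left flip: scaleR_scaleR)
  moreover have "s * \<phi> z + t * \<psi> z \<in> {0..1}" for z
    using st \<phi>(2)[of z] \<psi>(2)[of z] convex_bound_le[of "\<phi> z" 1 "\<psi> z" s t] by auto
  moreover have "(\<lambda>z. s * \<phi> z + t * \<psi> z) \<in> borel_measurable borel" using \<phi>(1) \<psi>(1) by measurable
  ultimately show "s *\<^sub>R x + t *\<^sub>R y \<in> zonoid \<nu>"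
    unfolding zonoid_def by (intro CollectI exI[of _ "\<lambda>z. s * \<phi> z + t * \<psi> z"]) simp
qed

lemma norm_zonoid_le:
  fixes \<nu> :: "(real ^ 'n::finite) measure"
  assumes \<nu>: "sets \<nu> = sets borel" "integrable \<nu> norm" and "z \<in> zonoid \<nu>"
  shows "norm z \<le> (\<integral>x. norm x \<partial>\<nu>)"
proof -
  obtain \<phi> where \<phi>: "\<phi> \<in> borel_measurable borel" "\<And>x. \<phi> x \<in> {0..1}" "z = (\<integral>x. \<phi> x *\<^sub>R x \<partial>\<nu>)"
    using assms(3) unfolding zonoid_def by blast
  note int = integrable_weight_scaleR[OF \<nu> \<phi>(1,2)]
  have "norm z \<le> (\<integral>x. norm (\<phi> x *\<^sub>R x) \<partial>\<nu>)" unfolding \<phi>(3) by (rule integral_norm_bound)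
  also have "\<dots> \<le> (\<integral>x. norm x \<partial>\<nu>)"
    using integrable_norm[OF int] \<nu>(2) \<phi>(2) by (intro integral_mono) (auto simp: mult_left_le_one_le)
  finally show ?thesis .
qed

lemma integrable_positive_part_inner:
  fixes \<nu> :: "(real ^ 'n::finite) measure"
  assumes "sets \<nu> = sets borel" "integrable \<nu> norm"
  shows "integrable \<nu> (\<lambda>x. max 0 (u \<bullet> x))"
  using integrable_ident[OF assms] by auto

text \<open>With the next lemma this computes the support function of the zonoid in direction \<open>u\<close> as the
integral of the positive part of \<open>u \<bullet> x\<close>: among weights with values in \<open>[0, 1]\<close>, the indicator of the
half-space where \<open>u \<bullet> x\<close> is positive is optimal. So support functions of empirical zonoids are
sample averages.\<close>

lemma inner_zonoid_le:
  fixes \<nu> :: "(real ^ 'n::finite) measure"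
  assumes \<nu>: "sets \<nu> = sets borel" "integrable \<nu> norm" and "z \<in> zonoid \<nu>"
  shows "u \<bullet> z \<le> (\<integral>x. max 0 (u \<bullet> x) \<partial>\<nu>)"
proof -
  obtain \<phi> where \<phi>: "\<phi> \<in> borel_measurable borel" "\<And>x. \<phi> x \<in> {0..1}" "z = (\<integral>x. \<phi> x *\<^sub>R x \<partial>\<nu>)"
    using assms(3) unfolding zonoid_def by blast
  note int = integrable_weight_scaleR[OF \<nu> \<phi>(1,2)]
  have "u \<bullet> z = (\<integral>x. \<phi> x * (u \<bullet> x) \<partial>\<nu>)"
    unfolding \<phi>(3) using integral_inner_right[of u \<nu> "\<lambda>x. \<phi> x *\<^sub>R x"] int by simp
  also have "\<dots> \<le> (\<integral>x. max 0 (u \<bullet> x) \<partial>\<nu>)"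
  proof (rule integral_mono)
    show "integrable \<nu> (\<lambda>x. \<phi> x * (u \<bullet> x))" using integrable_inner_right[of u \<nu> "\<lambda>x. \<phi> x *\<^sub>R x"] int by simp
    show "integrable \<nu> (\<lambda>x. max 0 (u \<bullet> x))" by (rule integrable_positive_part_inner[OF \<nu>])
    show "\<phi> x * (u \<bullet> x) \<le> max 0 (u \<bullet> x)" for x
    proof -
      have "\<phi> x * (u \<bullet> x) \<le> \<phi> x * max 0 (u \<bullet> x)" using \<phi>(2)[of x] by (intro mult_left_mono) auto
      also have "\<dots> \<le> max 0 (u \<bullet> x)" using \<phi>(2)[of x] by (intro mult_left_le_one_le) auto
      finally show ?thesis .
    qed
  qed
  finally show ?thesis .
qed

lemma inner_zonoid_attained:
  fixes \<nu> :: "(real ^ 'n::finite) measure"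
  assumes \<nu>: "sets \<nu> = sets borel" "integrable \<nu> norm"
  obtains z where "z \<in> zonoid \<nu>" "u \<bullet> z = (\<integral>x. max 0 (u \<bullet> x) \<partial>\<nu>)"
proof
  let ?\<phi> = "indicat_real {x. 0 < u \<bullet> x}"
  have \<phi>: "?\<phi> \<in> borel_measurable borel" "\<And>x. ?\<phi> x \<in> {0..1}" by (auto simp: indicator_def)
  show "(\<integral>x. ?\<phi> x *\<^sub>R x \<partial>\<nu>) \<in> zonoid \<nu>" unfolding zonoid_def using \<phi> by blast
  have "u \<bullet> (\<integral>x. ?\<phi> x *\<^sub>R x \<partial>\<nu>) = (\<integral>x. u \<bullet> (?\<phi> x *\<^sub>R x) \<partial>\<nu>)"
    using integral_inner_right[of u \<nu> "\<lambda>x. ?\<phi> x *\<^sub>R x"] integrable_weight_scaleR[OF \<nu> \<phi>] by simp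
  also have "\<dots> = (\<integral>x. max 0 (u \<bullet> x) \<partial>\<nu>)"
    by (intro Bochner_Integration.integral_cong) (auto simp: indicator_def)
  finally show "u \<bullet> (\<integral>x. ?\<phi> x *\<^sub>R x \<partial>\<nu>) = (\<integral>x. max 0 (u \<bullet> x) \<partial>\<nu>)" .
qed

text \<open>Countably many applications of the strong law give all that the convergence criterion for convex
sets asks of the empirical zonoids. A fixed weight function yields a point of each empirical zonoid, and these
points converge; a fixed direction yields support values, and these converge;
the sample means of the norm converge, so they bound all the zonoids at once.\<close>

lemma (in prob_space) zonoid_volume_empirical_tendsto:
  fixes X :: "nat \<Rightarrow> 'a \<Rightarrow> real ^ 'n::finite"
  assumes indep: "indep_vars (\<lambda>_. borel) X {1..}"
    and law: "\<And>i. i \<ge> 1 \<Longrightarrow> distr M borel (X i) = \<mu>"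
    and \<mu>: "sets \<mu> = sets borel" "integrable \<mu> norm"
  shows "AE \<omega> in M. (\<lambda>N. measure lebesgue (zonoid (empirical_measure N (\<lambda>i. X i \<omega>))))
    \<longlonglongrightarrow> measure lebesgue (zonoid \<mu>)"
proof -
  let ?E = "\<lambda>N \<omega>. empirical_measure N (\<lambda>i. X i \<omega>)"
  note LLN = empirical_integral_tendsto[OF indep law]
  have E: "sets (?E N \<omega>) = sets borel" "integrable (?E N \<omega>) norm" for N \<omega>
    by (simp_all add: integrable_empirical_measure)
  \<comment> \<open>Weight functions whose integrals are dense in the zonoid: the same weights,
      integrated against the empirical measures, give the points approaching it from inside.\<close>
  obtain T where T: "countable T" "T \<subseteq> zonoid \<mu>" "zonoid \<mu> \<subseteq> closure T"
    by (rule separable)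
  have "\<forall>d\<in>T. \<exists>\<phi>. \<phi> \<in> borel_measurable borel \<and> (\<forall>x. \<phi> x \<in> {0..1}) \<and> d = (\<integral>x. \<phi> x *\<^sub>R x \<partial>\<mu>)"
    using T(2) unfolding zonoid_def by blast
  then obtain \<phi> where \<phi>: "\<And>d. d \<in> T \<Longrightarrow> \<phi> d \<in> borel_measurable borel"
      "\<And>d x. d \<in> T \<Longrightarrow> \<phi> d x \<in> {0..1::real}" "\<And>d. d \<in> T \<Longrightarrow> d = (\<integral>x. \<phi> d x *\<^sub>R x \<partial>\<mu>)"
    using bchoice[of T "\<lambda>d \<phi>. \<phi> \<in> borel_measurable borel \<and> (\<forall>x. \<phi> x \<in> {0..1}) \<and> d = (\<integral>x. \<phi> x *\<^sub>R x \<partial>\<mu>)"]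
    by blast
  obtain U :: "(real ^ 'n) set" where U: "countable U" "\<And>W. open W \<Longrightarrow> W \<noteq> {} \<Longrightarrow> \<exists>u\<in>U. u \<in> W"
    using countable_dense_exists[where 'a = "real ^ 'n"] by auto
  have "AE \<omega> in M. \<forall>d\<in>T. (\<lambda>N. \<integral>x. \<phi> d x *\<^sub>R x \<partial>?E N \<omega>) \<longlonglongrightarrow> d"
  proof (intro AE_ball_countable[THEN iffD2] ballI T(1))
    fix d assume d: "d \<in> T"
    show "AE \<omega> in M. (\<lambda>N. \<integral>x. \<phi> d x *\<^sub>R x \<partial>?E N \<omega>) \<longlonglongrightarrow> d"
      using LLN[of "\<lambda>x. \<phi> d x *\<^sub>R x"] \<phi>[OF d] integrable_weight_scaleR[OF \<mu> \<phi>(1)[OF d] \<phi>(2)[OF d]]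
      by simp
  qed
  moreover have "AE \<omega> in M. \<forall>u\<in>U. (\<lambda>N. \<integral>x. max 0 (u \<bullet> x) \<partial>?E N \<omega>) \<longlonglongrightarrow> (\<integral>x. max 0 (u \<bullet> x) \<partial>\<mu>)"
    by (intro AE_ball_countable[THEN iffD2] ballI U(1) LLN integrable_positive_part_inner[OF \<mu>]) measurable
  moreover have "AE \<omega> in M. (\<lambda>N. \<integral>x. norm x \<partial>?E N \<omega>) \<longlonglongrightarrow> (\<integral>x. norm x \<partial>\<mu>)"
    by (intro LLN \<mu>) measurable
  ultimately show ?thesis
  proof eventually_elim
    case (elim \<omega>)
    obtain R where R: "\<And>N. norm (\<integral>x. norm x \<partial>?E N \<omega>) \<le> R"
      using convergent_imp_Bseq[OF convergentI[OF elim(3)]] by (auto simp: Bseq_def)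
    show ?case
    proof (rule convex_volume_tendsto[where R = R and D = T and U = U])
      show "convex (zonoid \<mu>)" "\<And>N. convex (zonoid (?E N \<omega>))"
        by (intro convex_zonoid \<mu> E)+
      show "bounded (zonoid \<mu>)" using norm_zonoid_le[OF \<mu>] by (auto simp: bounded_iff)
      show "zonoid (?E N \<omega>) \<subseteq> cball 0 R" for N
      proof
        fix z assume "z \<in> zonoid (?E N \<omega>)"
        then show "z \<in> cball 0 R" using norm_zonoid_le[OF E, of z N \<omega>] R[of N] by simp
      qed
      show "\<exists>z. (\<forall>N. z N \<in> zonoid (?E N \<omega>)) \<and> z \<longlonglongrightarrow> d" if d: "d \<in> T" for d
      proof (intro exI conjI allI)
        show "(\<lambda>N. \<integral>x. \<phi> d x *\<^sub>R x \<partial>?E N \<omega>) \<longlonglongrightarrow> d" using elim(1) d by blast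
        show "(\<integral>x. \<phi> d x *\<^sub>R x \<partial>?E N \<omega>) \<in> zonoid (?E N \<omega>)" for N
          using \<phi>(1,2)[OF d] unfolding zonoid_def by blast
      qed
      show "\<forall>\<^sub>F N in sequentially. \<forall>z\<in>zonoid (?E N \<omega>). u \<bullet> z < c"
        if u: "u \<in> U" and bc: "b < c" "\<And>z. z \<in> zonoid \<mu> \<Longrightarrow> u \<bullet> z \<le> b" for u b c
      proof -
        obtain z where "z \<in> zonoid \<mu>" "u \<bullet> z = (\<integral>x. max 0 (u \<bullet> x) \<partial>\<mu>)"
          by (rule inner_zonoid_attained[OF \<mu>])
        then have "(\<integral>x. max 0 (u \<bullet> x) \<partial>\<mu>) < c" using bc(1) bc(2)[of z] by simp
        then have "\<forall>\<^sub>F N in sequentially. (\<integral>x. max 0 (u \<bullet> x) \<partial>?E N \<omega>) < c"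
          using elim(2) u by (intro order_tendstoD(2)) auto
        then show ?thesis
        proof eventually_elim
          case (elim N)
          then show ?case using inner_zonoid_le[OF E, of _ N \<omega> u] by (meson le_less_trans)
        qed
      qed
    qed (use T U in auto)
  qed
qed

section \<open>The Gini index\<close>

lemma measure_parallelotope:
  assumes "\<And>j. 0 \<le> mean_vector \<nu> $ j"
  shows "measure lebesgue (parallelotope \<nu>) = (\<Prod>j\<in>UNIV. mean_vector \<nu> $ j)"
proof -
  have eq: "parallelotope \<nu> = cbox 0 (mean_vector \<nu>)"
    by (auto simp: parallelotope_def simp flip: interval_cbox_cart)
  have "0 \<in> parallelotope \<nu>" using assms by (simp add: parallelotope_def less_eq_vec_def)
  then show ?thesis using content_cbox_cart[of 0 "mean_vector \<nu>"] unfolding eq by auto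
qed

text \<open>A point outside the orthant has the complement of the closed orthant as an open neighbourhood, and this
contains no sample point.\<close>

lemma empirical_measure_in_P1_plus:
  fixes x :: "nat \<Rightarrow> real ^ 'n::finite"
  assumes N: "1 \<le> N" and x: "\<And>i. 1 \<le> i \<Longrightarrow> 0 \<le> x i"
  shows "empirical_measure N x \<in> P1_plus"
proof -
  have "closed {y :: real ^ 'n. 0 \<le> y}"
    unfolding less_eq_vec_def
    by (intro closed_Collect_all closed_Collect_le continuous_intros)
  then have op: "open (- {y :: real ^ 'n. 0 \<le> y})" by (rule open_Compl)
  have "emeasure (empirical_measure N x) (- {y. 0 \<le> y}) = 0"
    using op x by (simp add: emeasure_empirical_measure borel_open indicator_def)
  then have "measure_support (empirical_measure N x) \<subseteq> {y. 0 \<le> y}"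
    unfolding measure_support_def using op by fastforce
  then show ?thesis
    using prob_space_empirical_measure[OF N] by (simp add: P1_plus_def integrable_empirical_measure)
qed

theorem theorem4p13:
  fixes m :: nat
    and \<mu> :: "(real ^ 'n::finite) measure"
    and M :: "'w measure"
    and X :: "nat \<Rightarrow> 'w \<Rightarrow> real ^ 'n"
  assumes "m \<ge> 1" and "CARD('n) = m + 1"
    and "\<mu> \<in> P1_plus"
    and "\<forall>j. 0 < mean_vector \<mu> $ j"
    and "prob_space M"
    and "prob_space.indep_vars M (\<lambda>_. borel) X {1..}"
    and "\<And>i \<omega>. i \<ge> 1 \<Longrightarrow> \<omega> \<in> space M \<Longrightarrow> 0 \<le> X i \<omega>"
    and "\<And>i. i \<ge> 1 \<Longrightarrow> distr M borel (X i) = \<mu>"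
  shows "AE \<omega> in M.
      (\<forall>\<^sub>F N in sequentially. gini_defined (empirical_measure N (\<lambda>i. X i \<omega>))) \<and>
      (\<lambda>N. gini_index (empirical_measure N (\<lambda>i. X i \<omega>))) \<longlonglongrightarrow> gini_index \<mu>"
proof -
  note \<mu> = \<open>\<mu> \<in> P1_plus\<close>
  interpret prob_space M by fact
  let ?E = "\<lambda>N \<omega>. empirical_measure N (\<lambda>i. X i \<omega>)"
  have \<mu>': "sets \<mu> = sets borel" "integrable \<mu> norm" using \<mu> by (auto simp: P1_plus_def)
  have int_coord: "integrable \<mu> (\<lambda>x. x $ j)" for j
    using integrable_inner_left[of "axis j 1" \<mu> "\<lambda>x. x"] integrable_ident[OF \<mu>'] by (simp add: inner_axis)
  have "AE \<omega> in M. \<forall>j. (\<lambda>N. mean_vector (?E N \<omega>) $ j) \<longlonglongrightarrow> mean_vector \<mu> $ j"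
    unfolding mean_vector_def vec_lambda_beta
    by (intro AE_all_countable[THEN iffD2] allI
        empirical_integral_tendsto[OF assms(6,8)] int_coord) measurable
  moreover have "AE \<omega> in M. (\<lambda>N. measure lebesgue (zonoid (?E N \<omega>))) \<longlonglongrightarrow> measure lebesgue (zonoid \<mu>)"
    using assms(6,8) \<mu>' by (rule zonoid_volume_empirical_tendsto)
  ultimately show ?thesis using AE_space
  proof eventually_elim
    case (elim \<omega>)
    note mean = elim(1)[rule_format]
    \<comment> \<open>Each of the finitely many limits is positive, so eventually all sample means are.\<close>
    have "\<forall>\<^sub>F N in sequentially. \<forall>j. 0 < mean_vector (?E N \<omega>) $ j"
      using order_tendstoD(1)[OF mean] assms(4) by (intro eventually_all_finite) auto
    then have gini: "\<forall>\<^sub>F N in sequentially. gini_defined (?E N \<omega>)"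
      using eventually_ge_at_top[of 1]
    proof eventually_elim
      case (elim N)
      then show ?case
        using empirical_measure_in_P1_plus[of N "\<lambda>i. X i \<omega>"] assms(7) \<open>\<omega> \<in> space M\<close>
        by (simp add: gini_defined_def)
    qed
    have "(\<lambda>N. \<Prod>j\<in>UNIV. mean_vector (?E N \<omega>) $ j) \<longlonglongrightarrow> (\<Prod>j\<in>UNIV. mean_vector \<mu> $ j)"
      by (intro tendsto_prod mean)
    moreover have "\<forall>\<^sub>F N in sequentially. (\<Prod>j\<in>UNIV. mean_vector (?E N \<omega>) $ j) = measure lebesgue (parallelotope (?E N \<omega>))"
      using gini by eventually_elim (simp add: gini_defined_def measure_parallelotope less_imp_le)
    ultimately have "(\<lambda>N. measure lebesgue (parallelotope (?E N \<omega>))) \<longlonglongrightarrow> (\<Prod>j\<in>UNIV. mean_vector \<mu> $ j)"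
      by (rule Lim_transform_eventually)
    then have par: "(\<lambda>N. measure lebesgue (parallelotope (?E N \<omega>))) \<longlonglongrightarrow> measure lebesgue (parallelotope \<mu>)"
      using assms(4) by (simp add: measure_parallelotope less_imp_le)
    have par0: "measure lebesgue (parallelotope \<mu>) \<noteq> 0"
      using assms(4) by (simp add: measure_parallelotope less_imp_le less_imp_neq[symmetric])
    show ?case
      unfolding gini_index_def using gini tendsto_divide[OF elim(2) par par0] by simp
  qed
qed

end
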